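(* Let $G$ be a finite simple connected graph of order $n\ge 2$. Then the following hold. (i) $eqdim(G)\le n-\Delta(G)$. Moreover, this bound is tight whenever the maximum degree is at least $n/2$: for all integers $n\ge 2$ and $\Delta$ with $n/2\le \Delta\le n-1$ there exists a finite simple connected graph $H$ of order $n$ with $\Delta(H)=\Delta$ and $eqdim(H)=n-\Delta$. (ii) $eqdim(G)\le n-\omega(G)+1$. (iii) $eqdim(G)\le \dfrac{n(D(G)-1)+1}{D(G)}$. (iv) If $D(G)=2$, then $eqdim(G)\le n-\alpha(G)+1$.
   Context: All graphs are finite, simple, undirected and connected; $d(x,y)$ denotes the graph distance. A set $S\subseteq V(G)$ is a distance-equalizer set of $G$ if for every two distinct vertices $x,y\in V(G)\setminus S$ there is $w\in S$ with $d(x,w)=d(y,w)$. The equidistant dimension $eqdim(G)$ is the minimum cardinality of a distance-equalizer set of $G$. $\Delta(G)$ is the maximum degree, $\omega(G)$ the clique number (maximum size of a set of pairwise adjacent vertices), $\alpha(G)$ the independence number (maximum size of a set of pairwise non-adjacent vertices), and $D(G)$ the diameter. *)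

theory Defs
  imports "Graph_Theory.Graph_Theory"
begin

text \<open>
  Finite simple undirected graphs are the instances of the locale \<^locale>\<open>graph\<close>: each edge
  is a pair of opposite arcs, so the degree of a vertex is its out-degree.
\<close>

text \<open>Length of a shortest path; meaningful only if \<open>v\<close> is reachable from \<open>u\<close>.\<close>

definition gdist :: "('a, 'b) pre_digraph \<Rightarrow> 'a \<Rightarrow> 'a \<Rightarrow> nat" where
  "gdist G u v = (LEAST k. \<exists>p. pre_digraph.apath G u p v \<and> length p = k)"

lemma (in wf_digraph) mu_unit_eq_gdist:
  assumes "u \<rightarrow>\<^sup>* v"
  shows "\<mu> (\<lambda>_. 1) u v = ereal (real (gdist G u v))"
proof -
  have cost: "awalk_cost (\<lambda>_. 1) p = real (length p)" for p :: "'b list"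
    by (induction p) auto
  from assms obtain q where "apath u q v"
    using reachable_apath by blast
  then have "\<exists>p. apath u p v \<and> length p = gdist G u v"
    unfolding gdist_def by (intro LeastI_ex[where P = "\<lambda>k. \<exists>p. apath u p v \<and> length p = k"]) blast
  then obtain p where p: "apath u p v" "length p = gdist G u v"
    by blast
  have le: "gdist G u v \<le> length r" if r: "awalk u r v" for r
  proof -
    have "apath u (awalk_to_apath r) v"
      using r by (rule apath_awalk_to_apath)
    then have "gdist G u v \<le> length (awalk_to_apath r)"
      unfolding gdist_def by (intro Least_le) blast
    also have "\<dots> \<le> length r"
      using awalk_to_path_no_neg_cyc_cost[OF r, of "\<lambda>_. 1"] by (simp add: cost)
    finally show ?thesis .
  qed
  show ?thesis
    unfolding \<mu>_def cost
  proof (rule INF_eqI)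
    show "ereal (real (gdist G u v)) \<le> ereal (real (length r))" if "r \<in> {p. awalk u p v}" for r
      using le that by simp
    show "y \<le> ereal (real (gdist G u v))"
      if "\<And>i. i \<in> {p. awalk u p v} \<Longrightarrow> y \<le> ereal (real (length i))" for y
      using that[of p] p by (auto dest: awalkI_apath)
  qed
qed

definition diameter :: "('a, 'b) pre_digraph \<Rightarrow> nat" where
  "diameter G = Max {gdist G u v | u v. u \<in> verts G \<and> v \<in> verts G}"

definition max_degree :: "('a, 'b) pre_digraph \<Rightarrow> nat" where
  "max_degree G = Max (out_degree G ` verts G)"

definition clique :: "('a, 'b) pre_digraph \<Rightarrow> 'a set \<Rightarrow> bool" where
  "clique G K \<longleftrightarrow> K \<subseteq> verts G \<and> (\<forall>u\<in>K. \<forall>v\<in>K. u \<noteq> v \<longrightarrow> u \<rightarrow>\<^bsub>G\<^esub> v)"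

definition clique_number :: "('a, 'b) pre_digraph \<Rightarrow> nat" where
  "clique_number G = Max (card ` {K. clique G K})"

definition independent_verts :: "('a, 'b) pre_digraph \<Rightarrow> 'a set \<Rightarrow> bool" where
  "independent_verts G I \<longleftrightarrow> I \<subseteq> verts G \<and> (\<forall>u\<in>I. \<forall>v\<in>I. \<not> u \<rightarrow>\<^bsub>G\<^esub> v)"

definition independence_number :: "('a, 'b) pre_digraph \<Rightarrow> nat" where
  "independence_number G = Max (card ` {I. independent_verts G I})"

definition distance_equalizer :: "('a, 'b) pre_digraph \<Rightarrow> 'a set \<Rightarrow> bool" where
  "distance_equalizer G S \<longleftrightarrow> S \<subseteq> verts G \<and>
    (\<forall>x \<in> verts G - S. \<forall>y \<in> verts G - S. x \<noteq> y \<longrightarrow> (\<exists>w\<in>S. gdist G x w = gdist G y w))"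

definition eqdim :: "('a, 'b) pre_digraph \<Rightarrow> nat" where
  "eqdim G = Min (card ` {S. distance_equalizer G S})"

end

theory Submission
  imports Defs
begin

text \<open>
  All four upper bounds come from a single observation: if \<open>w\<close> is a vertex and \<open>A\<close> is a set of
  other vertices that all have the same distance to \<open>w\<close>, then the complement of \<open>A\<close> is a
  distance-equalizer set, because it contains \<open>w\<close>, which equalizes every two vertices of \<open>A\<close>.
  Hence \<open>eqdim G \<le> n - card A\<close> (lemma \<open>eqdim_le_of_equidistant\<close>), and each bound
  is a choice of \<open>w\<close> and \<open>A\<close>: the neighbours of a vertex of maximum degree; a maximum clique without
  one of its vertices (distance 1); a largest distance class around an arbitrary vertex, which
  has at least \<open>(n - 1) / D\<close> elements because \<open>D\<close> classes cover the other \<open>n - 1\<close> vertices; and,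
  in diameter 2, a maximum independent set without one of its vertices (distance 2).

  For the sharpness of the degree bound, take the complete bipartite graph with parts of sizes
  \<open>m - k \<le> k\<close>. It has maximum degree \<open>k\<close>. Two vertices \<open>x\<close>, \<open>y\<close> from different parts
  cannot be equalized: a vertex \<open>w\<close> is adjacent to exactly one of them, so exactly one of the two
  distances to \<open>w\<close> is 1. A distance-equalizer set therefore contains one of the parts, and so has
  at least \<open>m - k\<close> elements.
\<close>

section \<open>Distance, degree and extremal sets in a graph\<close>

context wf_digraph
begin

lemma gdist_apath:
  assumes "u \<rightarrow>\<^sup>* v"
  obtains p where "apath u p v" "length p = gdist G u v"
proof -
  from assms obtain q where "apath u q v"
    using reachable_apath by blast
  then have "\<exists>p. apath u p v \<and> length p = gdist G u v"
    unfolding gdist_def by (intro LeastI_ex[where P = "\<lambda>k. \<exists>p. apath u p v \<and> length p = k"]) blast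
  with that show thesis
    by blast
qed

lemma gdist_le: "apath u p v \<Longrightarrow> gdist G u v \<le> length p"
  unfolding gdist_def by (intro Least_le) blast

lemma gdist_eq_0_iff:
  assumes "u \<rightarrow>\<^sup>* v"
  shows "gdist G u v = 0 \<longleftrightarrow> u = v"
proof
  assume "gdist G u v = 0"
  with gdist_apath[OF assms] show "u = v"
    by (metis apath_Nil_iff length_0_conv)
next
  assume "u = v"
  moreover have "u \<in> verts G"
    using assms by (rule reachable_in_vertsE)
  ultimately show "gdist G u v = 0"
    using gdist_le[of u "[]" v] by (simp add: apath_Nil_iff)
qed

lemma gdist_eq_1_iff:
  assumes "u \<rightarrow>\<^sup>* v" and "u \<noteq> v"
  shows "gdist G u v = 1 \<longleftrightarrow> u \<rightarrow>\<^bsub>G\<^esub> v"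
proof
  assume "gdist G u v = 1"
  with gdist_apath[OF assms(1)] obtain p where "apath u p v" "length p = 1"
    by metis
  then obtain e where "apath u [e] v"
    by (cases p) auto
  then show "u \<rightarrow>\<^bsub>G\<^esub> v"
    by (auto simp: apath_simps arc_to_ends_def intro: dominatesI)
next
  assume "u \<rightarrow>\<^bsub>G\<^esub> v"
  then obtain e where "e \<in> arcs G" "tail G e = u" "head G e = v"
    by (rule reachableE)
  then have "apath u [e] v"
    using assms(2) by (auto simp: apath_simps)
  then have "gdist G u v \<le> 1"
    using gdist_le by fastforce
  moreover have "gdist G u v \<noteq> 0"
    using assms gdist_eq_0_iff by blast
  ultimately show "gdist G u v = 1"
    by simp
qed

end

lemma (in nomulti_digraph) out_degree_eq_card_out_neighbours:
  "out_degree G v = card {x. v \<rightarrow>\<^bsub>G\<^esub> x}"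
proof -
  have "inj_on (head G) (out_arcs G v)"
    by (auto simp: inj_on_def out_arcs_def arc_to_ends_def intro: no_multi_arcs)
  then have "card (head G ` out_arcs G v) = out_degree G v"
    unfolding out_degree_def by (rule card_image)
  moreover have "head G ` out_arcs G v = {x. v \<rightarrow>\<^bsub>G\<^esub> x}"
    by (auto simp: out_arcs_def arcs_ends_conv)
  ultimately show ?thesis
    by simp
qed

context fin_digraph
begin

lemma gdist_le_diameter:
  assumes "u \<in> verts G" "v \<in> verts G"
  shows "gdist G u v \<le> diameter G"
proof -
  have "{gdist G u v | u v. u \<in> verts G \<and> v \<in> verts G}
      = (\<lambda>(u, v). gdist G u v) ` (verts G \<times> verts G)"
    by auto
  then have "finite {gdist G u v | u v. u \<in> verts G \<and> v \<in> verts G}"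
    by simp
  then show ?thesis
    unfolding diameter_def using assms by (intro Max_ge) auto
qed

lemma max_degree_witness:
  assumes "verts G \<noteq> {}"
  obtains w where "w \<in> verts G" "out_degree G w = max_degree G"
proof -
  have "max_degree G \<in> out_degree G ` verts G"
    unfolding max_degree_def using assms by (intro Max_in) auto
  with that show thesis
    by auto
qed

lemma maximum_subset_witness:
  assumes "\<And>K. P K \<Longrightarrow> K \<subseteq> verts G" and "P {}"
  obtains K where "P K" "card K = Max (card ` {K. P K})"
proof -
  have "finite {K. P K}"
    by (rule finite_subset[of _ "Pow (verts G)"]) (use assms(1) in auto)
  moreover have "{K. P K} \<noteq> {}"
    using assms(2) by blast
  ultimately have "Max (card ` {K. P K}) \<in> card ` {K. P K}"
    by (intro Max_in) auto
  with that show thesis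
    by auto
qed

lemma clique_number_witness:
  obtains K where "clique G K" "card K = clique_number G"
proof (rule maximum_subset_witness[of "clique G"])
  show "clique G {}" "\<And>K. clique G K \<Longrightarrow> K \<subseteq> verts G"
    by (auto simp: clique_def)
qed (auto simp: clique_number_def intro: that)

lemma independence_number_witness:
  obtains I where "independent_verts G I" "card I = independence_number G"
proof (rule maximum_subset_witness[of "independent_verts G"])
  show "independent_verts G {}" "\<And>I. independent_verts G I \<Longrightarrow> I \<subseteq> verts G"
    by (auto simp: independent_verts_def)
qed (auto simp: independence_number_def intro: that)

section \<open>Upper bounds for the equidistant dimension\<close>

lemma finite_distance_equalizers: "finite {S. distance_equalizer G S}"
  by (rule finite_subset[of _ "Pow (verts G)"]) (auto simp: distance_equalizer_def)

lemma eqdim_le: "distance_equalizer G S \<Longrightarrow> eqdim G \<le> card S"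
  unfolding eqdim_def using finite_distance_equalizers by (intro Min_le) auto

lemma eqdim_ge:
  assumes "\<And>S. distance_equalizer G S \<Longrightarrow> k \<le> card S"
  shows "k \<le> eqdim G"
proof -
  have "distance_equalizer G (verts G)"
    by (simp add: distance_equalizer_def)
  then show ?thesis
    unfolding eqdim_def using assms finite_distance_equalizers by (subst Min_ge_iff) auto
qed

text \<open>
  The complement of \<open>A\<close> is a distance-equalizer set: \<open>w\<close> lies in it and equalizes any two vertices
  of \<open>A\<close>. All upper bounds below are instances.
\<close>

lemma eqdim_le_of_equidistant:
  assumes "w \<in> verts G" and "A \<subseteq> verts G - {w}" and "\<And>x. x \<in> A \<Longrightarrow> gdist G x w = c"
  shows "eqdim G + card A \<le> card (verts G)"
proof -
  have "distance_equalizer G (verts G - A)"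
    unfolding distance_equalizer_def
  proof (intro conjI ballI impI bexI)
    show "w \<in> verts G - A"
      using assms(1,2) by blast
  qed (use assms(3) in auto)
  then have "eqdim G \<le> card (verts G - A)"
    by (rule eqdim_le)
  moreover have "A \<subseteq> verts G"
    using assms(2) by blast
  moreover from this have "card A \<le> card (verts G)"
    by (intro card_mono) auto
  ultimately show ?thesis
    using finite_subset[of A "verts G"] by (simp add: card_Diff_subset)
qed

end

locale connected_graph = graph G for G :: "('a, 'b) pre_digraph" (structure) +
  assumes connected: "Digraph_Component.connected G"
begin

lemma reachable: "u \<in> verts G \<Longrightarrow> v \<in> verts G \<Longrightarrow> u \<rightarrow>\<^sup>* v"
  using symmetric_connected_imp_strongly_connected[OF sym_arcs connected]
  by (simp add: strongly_connected_def)

lemma verts_nonempty: "verts G \<noteq> {}"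
  using symmetric_connected_imp_strongly_connected[OF sym_arcs connected]
  by (simp add: strongly_connected_def)

lemma gdist_adjacent:
  assumes "u \<rightarrow>\<^bsub>G\<^esub> v"
  shows "gdist G u v = 1"
proof -
  have "u \<noteq> v"
    using assms adj_not_same by blast
  with reachable[OF adj_in_verts[OF assms]] assms show ?thesis
    using gdist_eq_1_iff by simp
qed

lemma eqdim_le_max_degree: "eqdim G + max_degree G \<le> card (verts G)"
proof -
  from verts_nonempty obtain w where w: "w \<in> verts G" "out_degree G w = max_degree G"
    by (rule max_degree_witness)
  have "{x. w \<rightarrow>\<^bsub>G\<^esub> x} \<subseteq> verts G - {w}"
    using adj_in_verts adj_not_same by blast
  moreover have "gdist G x w = 1" if "x \<in> {x. w \<rightarrow>\<^bsub>G\<^esub> x}" for x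
    using that arcs_ends_symmetric[OF sym_arcs] gdist_adjacent by blast
  ultimately have "eqdim G + card {x. w \<rightarrow>\<^bsub>G\<^esub> x} \<le> card (verts G)"
    by (rule eqdim_le_of_equidistant[OF w(1)])
  then show ?thesis
    using w(2) by (simp add: out_degree_eq_card_out_neighbours)
qed

text \<open>
  This is the common form of the bounds by cliques and by independent sets: in a set of pairwise equidistant
  vertices, any one of them equalizes all the others.
\<close>

lemma eqdim_le_of_pairwise_equidistant:
  assumes "A \<subseteq> verts G" and "\<And>x y. x \<in> A \<Longrightarrow> y \<in> A \<Longrightarrow> x \<noteq> y \<Longrightarrow> gdist G x y = c"
  shows "eqdim G + card A \<le> card (verts G) + 1"
proof (cases "A = {}")
  case True
  then show ?thesis
    using eqdim_le[of "verts G"] by (simp add: distance_equalizer_def)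
next
  case False
  then obtain w where "w \<in> A"
    by blast
  have "eqdim G + card (A - {w}) \<le> card (verts G)"
    by (rule eqdim_le_of_equidistant) (use assms \<open>w \<in> A\<close> in auto)
  then show ?thesis
    using \<open>w \<in> A\<close> finite_subset[OF assms(1)] by (simp add: card_Diff_singleton)
qed

lemma eqdim_le_clique_number: "eqdim G + clique_number G \<le> card (verts G) + 1"
proof -
  obtain K where K: "clique G K" "card K = clique_number G"
    by (rule clique_number_witness)
  have "eqdim G + card K \<le> card (verts G) + 1"
    by (rule eqdim_le_of_pairwise_equidistant)
      (use K(1) gdist_adjacent in \<open>auto simp: clique_def\<close>)
  then show ?thesis
    using K(2) by simp
qed

lemma eqdim_le_independence_number:
  assumes "diameter G = 2"
  shows "eqdim G + independence_number G \<le> card (verts G) + 1"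
proof -
  obtain I where I: "independent_verts G I" "card I = independence_number G"
    by (rule independence_number_witness)
  have "eqdim G + card I \<le> card (verts G) + 1"
  proof (rule eqdim_le_of_pairwise_equidistant)
    show "I \<subseteq> verts G"
      using I(1) by (simp add: independent_verts_def)
  next
    fix x y
    assume xy: "x \<in> I" "y \<in> I" "x \<noteq> y"
    then have V: "x \<in> verts G" "y \<in> verts G" and "\<not> x \<rightarrow>\<^bsub>G\<^esub> y"
      using I(1) by (auto simp: independent_verts_def)
    with xy(3) have "gdist G x y \<noteq> 0" "gdist G x y \<noteq> 1"
      using gdist_eq_0_iff[OF reachable[OF V]] gdist_eq_1_iff[OF reachable[OF V]] by simp_all
    moreover have "gdist G x y \<le> 2"
      using gdist_le_diameter[OF V] assms by simp
    ultimately show "gdist G x y = 2"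
      by linarith
  qed
  then show ?thesis
    using I(2) by simp
qed

text \<open>
  The vertices other than a fixed \<open>w\<close> are covered by the classes of vertices at distance
  \<open>1, \<dots>, diameter G\<close> to \<open>w\<close>. Each class is equidistant from \<open>w\<close> and so has at most
  \<open>card (verts G) - eqdim G\<close> elements. The resulting inequality is stated without subtraction or
  division, so that it makes sense for a single vertex too, where the diameter is 0.
\<close>

lemma eqdim_diameter_bound:
  "diameter G * eqdim G + card (verts G) \<le> diameter G * card (verts G) + 1"
proof -
  from verts_nonempty obtain w where w: "w \<in> verts G"
    by blast
  define L where "L c = {x \<in> verts G - {w}. gdist G x w = c}" for c
  have "verts G - {w} = (\<Union>c \<in> {1..diameter G}. L c)"
  proof -
    have "gdist G x w \<in> {1..diameter G}" if "x \<in> verts G - {w}" for x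
      using that w gdist_le_diameter[of x w] gdist_eq_0_iff[OF reachable, of x w]
      by (auto simp: Suc_le_eq)
    then show ?thesis
      unfolding L_def by blast
  qed
  then have "card (verts G - {w}) \<le> (\<Sum>c = 1..diameter G. card (L c))"
    using card_UN_le[of "{1..diameter G}" L] by simp
  then have "card (verts G) - 1 \<le> (\<Sum>c = 1..diameter G. card (L c))"
    using w by (simp add: card_Diff_singleton)
  also have "\<dots> \<le> (\<Sum>c = 1..diameter G. card (verts G) - eqdim G)"
  proof (rule sum_mono)
    fix c
    have "eqdim G + card (L c) \<le> card (verts G)"
      by (rule eqdim_le_of_equidistant[OF w]) (auto simp: L_def)
    then show "card (L c) \<le> card (verts G) - eqdim G"
      by simp
  qed
  finally have "card (verts G) \<le> diameter G * (card (verts G) - eqdim G) + 1"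
    by simp
  then have "diameter G * eqdim G + card (verts G)
      \<le> diameter G * (eqdim G + (card (verts G) - eqdim G)) + 1"
    by (simp add: distrib_left)
  also have "eqdim G + (card (verts G) - eqdim G) = card (verts G)"
    using eqdim_le_max_degree by simp
  finally show ?thesis .
qed

lemma diameter_pos:
  assumes "card (verts G) \<ge> 2"
  shows "diameter G > 0"
proof -
  from assms obtain u v where uv: "u \<in> verts G" "v \<in> verts G" "u \<noteq> v"
    using card_le_Suc0_iff_eq[OF finite_verts] by fastforce
  then have "gdist G u v > 0"
    using gdist_eq_0_iff[OF reachable] by blast
  also have "gdist G u v \<le> diameter G"
    using uv by (simp add: gdist_le_diameter)
  finally show ?thesis .
qed

end

section \<open>Complete bipartite graphs\<close>

definition complete_bipartite :: "nat \<Rightarrow> nat \<Rightarrow> (nat, nat \<times> nat) pre_digraph" where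
  "complete_bipartite j k =
    \<lparr>verts = {..<j + k},
     arcs = {(u, v). u < j + k \<and> v < j + k \<and> (u < j \<longleftrightarrow> j \<le> v)},
     tail = fst, head = snd\<rparr>"

lemma verts_complete_bipartite: "verts (complete_bipartite j k) = {..<j + k}"
  by (simp add: complete_bipartite_def)

lemma adjacent_complete_bipartite:
  "u \<rightarrow>\<^bsub>complete_bipartite j k\<^esub> v \<longleftrightarrow> u < j + k \<and> v < j + k \<and> (u < j \<longleftrightarrow> j \<le> v)"
  by (auto simp: arcs_ends_conv complete_bipartite_def)

lemma graph_complete_bipartite: "graph (complete_bipartite j k)"
proof -
  have "finite (arcs (complete_bipartite j k))"
    by (rule finite_subset[of _ "{..<j + k} \<times> {..<j + k}"]) (auto simp: complete_bipartite_def)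
  moreover have "symmetric (complete_bipartite j k)"
    by (auto simp: symmetric_def sym_def adjacent_complete_bipartite)
  ultimately show ?thesis
    by unfold_locales (auto simp: complete_bipartite_def arc_to_ends_def)
qed

lemma connected_complete_bipartite:
  assumes "j > 0" "k > 0"
  shows "Digraph_Component.connected (complete_bipartite j k)"
proof -
  interpret graph "complete_bipartite j k"
    by (rule graph_complete_bipartite)
  let ?G = "complete_bipartite j k"
  \<comment> \<open>By symmetry it is enough to reach the vertex 0; a vertex of its own part gets there
    through the other part, which contains \<open>j\<close>.\<close>
  have to_0: "u \<rightarrow>\<^sup>*\<^bsub>?G\<^esub> 0" if "u < j + k" for u
  proof (cases "u < j")
    case True
    then have "u \<rightarrow>\<^bsub>?G\<^esub> j" "j \<rightarrow>\<^bsub>?G\<^esub> 0"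
      using assms by (auto simp: adjacent_complete_bipartite)
    then show ?thesis
      by (meson adj_reachable_trans reachable_adjI)
  next
    case False
    then have "u \<rightarrow>\<^bsub>?G\<^esub> 0"
      using assms that by (auto simp: adjacent_complete_bipartite)
    then show ?thesis
      by (rule reachable_adjI)
  qed
  have "u \<rightarrow>\<^sup>*\<^bsub>?G\<^esub> v" if "u \<in> verts ?G" "v \<in> verts ?G" for u v
  proof -
    have "u \<rightarrow>\<^sup>*\<^bsub>?G\<^esub> 0" "0 \<rightarrow>\<^sup>*\<^bsub>?G\<^esub> v"
      using that symmetric_reachable[OF sym_arcs to_0] to_0
      by (simp_all add: verts_complete_bipartite)
    then show ?thesis
      by (rule reachable_trans)
  qed
  moreover have "verts ?G \<noteq> {}"
    using assms by (auto simp: verts_complete_bipartite)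
  ultimately show ?thesis
    unfolding Digraph_Component.connected_def strongly_connected_def
    by (simp add: reachable_mk_symmetric_eq[OF sym_arcs])
qed

lemma max_degree_complete_bipartite:
  assumes "0 < j" "j \<le> k"
  shows "max_degree (complete_bipartite j k) = k"
proof -
  interpret graph "complete_bipartite j k"
    by (rule graph_complete_bipartite)
  have "{x. v \<rightarrow>\<^bsub>complete_bipartite j k\<^esub> x} = (if v < j then {j..<j + k} else {..<j})"
    if "v < j + k" for v
    using that by (auto simp: adjacent_complete_bipartite)
  then have deg: "out_degree (complete_bipartite j k) v = (if v < j then k else j)"
    if "v < j + k" for v
    using that by (simp add: out_degree_eq_card_out_neighbours)
  have "max_degree (complete_bipartite j k) = Max ((\<lambda>v. if v < j then k else j) ` {..<j + k})"
    unfolding max_degree_def verts_complete_bipartite using deg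
    by (intro arg_cong[where f = Max] image_cong) auto
  also have "\<dots> = k"
  proof (rule Max_eqI)
    \<comment> \<open>The maximum is attained in the smaller part, which contains the vertex 0.\<close>
    show "k \<in> (\<lambda>v. if v < j then k else j) ` {..<j + k}"
      using assms(1) by (intro image_eqI[where x = 0]) auto
  qed (use assms(2) in auto)
  finally show ?thesis .
qed

text \<open>
  Vertices \<open>x\<close>, \<open>y\<close> outside \<open>S\<close> from different parts could not be equalized, since every vertex is
  adjacent to exactly one of them. Hence \<open>S\<close> contains a whole part, and the smaller one has
  \<open>j\<close> elements.
\<close>

lemma card_distance_equalizer_complete_bipartite:
  assumes "0 < j" "j \<le> k" and S: "distance_equalizer (complete_bipartite j k) S"
  shows "j \<le> card S"
proof -
  interpret connected_graph "complete_bipartite j k"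
    using assms by (intro connected_graph.intro connected_graph_axioms.intro
        graph_complete_bipartite connected_complete_bipartite) auto
  let ?G = "complete_bipartite j k"
  have sub: "S \<subseteq> {..<j + k}"
    using S by (simp add: distance_equalizer_def verts_complete_bipartite)
  have fin: "finite S"
    using sub finite_subset by blast
  have "{..<j} \<subseteq> S \<or> {j..<j + k} \<subseteq> S"
  proof (rule ccontr)
    assume "\<not> ?thesis"
    then obtain x y where "x \<in> {..<j} - S" "y \<in> {j..<j + k} - S"
      by blast
    then have x: "x < j" "x \<notin> S" and y: "j \<le> y" "y < j + k" "y \<notin> S"
      by auto
    then have "x \<in> verts ?G - S" "y \<in> verts ?G - S" "x \<noteq> y"
      by (auto simp: verts_complete_bipartite)
    with S obtain w where w: "w \<in> S" "gdist ?G x w = gdist ?G y w"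
      unfolding distance_equalizer_def by blast
    have V: "x \<in> verts ?G" "y \<in> verts ?G" "w \<in> verts ?G" and "x \<noteq> w" "y \<noteq> w"
      using x y w(1) sub by (auto simp: verts_complete_bipartite)
    then have "x \<rightarrow>\<^bsub>?G\<^esub> w \<longleftrightarrow> y \<rightarrow>\<^bsub>?G\<^esub> w"
      using w(2) gdist_eq_1_iff[OF reachable, of x w] gdist_eq_1_iff[OF reachable, of y w] by simp
    then show False
      using x y V by (auto simp: adjacent_complete_bipartite verts_complete_bipartite)
  qed
  then show ?thesis
    using card_mono[OF fin, of "{..<j}"] card_mono[OF fin, of "{j..<j + k}"] assms(2) by auto
qed

text \<open>
  The lower bound is \<open>card_distance_equalizer_complete_bipartite\<close>; the matching upper bound is the
  degree bound itself, since the vertices of the smaller part have degree \<open>k\<close>.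
\<close>

lemma eqdim_complete_bipartite:
  assumes "0 < j" "j \<le> k"
  shows "eqdim (complete_bipartite j k) = j"
proof -
  interpret connected_graph "complete_bipartite j k"
    using assms by (intro connected_graph.intro connected_graph_axioms.intro
        graph_complete_bipartite connected_complete_bipartite) auto
  have "j \<le> eqdim (complete_bipartite j k)"
    by (rule eqdim_ge) (rule card_distance_equalizer_complete_bipartite[OF assms])
  moreover have "eqdim (complete_bipartite j k) \<le> j"
    using eqdim_le_max_degree
    by (simp add: max_degree_complete_bipartite[OF assms] verts_complete_bipartite)
  ultimately show ?thesis
    by simp
qed

section \<open>The bounds for a connected graph of order at least two\<close>

theorem proposition3:
  fixes G :: "('a, 'b) pre_digraph" and n :: nat
  assumes "graph G" and "Digraph_Component.connected G"
    and "card (verts G) = n" and "n \<ge> 2"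
  shows
    "(int (eqdim G) \<le> int n - int (max_degree G) \<and>
      (\<forall>m k :: nat. m \<ge> 2 \<longrightarrow> real m / 2 \<le> real k \<longrightarrow> k \<le> m - 1 \<longrightarrow>
        (\<exists>H :: (nat, nat \<times> nat) pre_digraph.
          graph H \<and> Digraph_Component.connected H \<and> card (verts H) = m \<and>
          max_degree H = k \<and> int (eqdim H) = int m - int k))) \<and>
     int (eqdim G) \<le> int n - int (clique_number G) + 1 \<and>
     real (eqdim G) \<le> (real n * (real (diameter G) - 1) + 1) / real (diameter G) \<and>
     (diameter G = 2 \<longrightarrow> int (eqdim G) \<le> int n - int (independence_number G) + 1)"
proof -
  interpret connected_graph G
    using assms(1,2) by (intro connected_graph.intro connected_graph_axioms.intro)
  have "int (eqdim G) \<le> int n - int (max_degree G)"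
    using eqdim_le_max_degree assms(3) by linarith
  moreover have "\<exists>H :: (nat, nat \<times> nat) pre_digraph.
      graph H \<and> Digraph_Component.connected H \<and> card (verts H) = m \<and>
      max_degree H = k \<and> int (eqdim H) = int m - int k"
    if "m \<ge> 2" "real m / 2 \<le> real k" "k \<le> m - 1" for m k :: nat
  proof (intro exI conjI)
    let ?H = "complete_bipartite (m - k) k"
    have j: "0 < m - k" "m - k \<le> k" "0 < k" and m: "m - k + k = m"
      using that by auto
    show "graph ?H"
      by (rule graph_complete_bipartite)
    show "Digraph_Component.connected ?H"
      using j by (simp add: connected_complete_bipartite)
    show "card (verts ?H) = m"
      using m by (simp add: verts_complete_bipartite)
    show "max_degree ?H = k"
      using j by (simp add: max_degree_complete_bipartite)
    show "int (eqdim ?H) = int m - int k"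
      using j m by (simp add: eqdim_complete_bipartite)
  qed
  moreover have "int (eqdim G) \<le> int n - int (clique_number G) + 1"
    using eqdim_le_clique_number assms(3) by linarith
  moreover have "real (eqdim G) \<le> (real n * (real (diameter G) - 1) + 1) / real (diameter G)"
  proof -
    have "real (diameter G * eqdim G + n) \<le> real (diameter G * n + 1)"
      using eqdim_diameter_bound assms(3) by (simp only: of_nat_le_iff)
    then show ?thesis
      using diameter_pos assms(3,4) by (simp add: pos_le_divide_eq algebra_simps)
  qed
  moreover have "int (eqdim G) \<le> int n - int (independence_number G) + 1" if "diameter G = 2"
    using eqdim_le_independence_number[OF that] assms(3) by linarith
  ultimately show ?thesis
    by blast
qed

end
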